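(* Let $n$ be a positive integer and let $\gamma_1,\gamma_2: S^n\to\mathbb{R}_+$ be convex integrands. Define $\gamma_{max}: S^n\to\mathbb{R}_+$ by $\gamma_{max}(\theta)=\max\{\gamma_1(\theta),\gamma_2(\theta)\}$. Then $\mathcal{W}_{\gamma_{max}}$ is the convex hull of $\mathcal{W}_{\gamma_1}\cup\mathcal{W}_{\gamma_2}$.
   Context: $S^n$ is the unit sphere in $\mathbb{R}^{n+1}$ and $\mathbb{R}_+$ is the set of positive real numbers. For a continuous function $\gamma:S^n\to\mathbb{R}_+$, the Wulff shape associated with $\gamma$ is $\mathcal{W}_\gamma=\bigcap_{\theta\in S^n}\{x\in\mathbb{R}^{n+1}\mid x\cdot\theta\le\gamma(\theta)\}$, where $\cdot$ is the dot product. Write $\mathrm{graph}(\gamma)=\{(\theta,\gamma(\theta))\mid\theta\in S^n\}\subset\mathbb{R}^{n+1}\setminus\{0\}$ in polar plot expression, i.e. $(\theta,r)$ with $\theta\in S^n$, $r>0$ denotes the point $r\theta\in\mathbb{R}^{n+1}\setminus\{0\}$. The inversion $\mathrm{inv}:\mathbb{R}^{n+1}\setminus\{0\}\to\mathbb{R}^{n+1}\setminus\{0\}$ is $\mathrm{inv}(\theta,r)=(-\theta,1/r)$. A continuous function $\gamma:S^n\to\mathbb{R}_+$ is called a convex integrand if $\mathrm{inv}(\mathrm{graph}(\gamma))$ equals the boundary of the convex hull of $\mathrm{inv}(\mathrm{graph}(\gamma))$. *)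

theory Defs
  imports "HOL-Analysis.Analysis"
begin

(* A function on the unit sphere is represented by a function on the whole space;
   every definition below depends only on its values on sphere 0 1. *)

definition Wulff_shape :: "('a::euclidean_space \<Rightarrow> real) \<Rightarrow> 'a set" where
  "Wulff_shape \<gamma> = (\<Inter>\<theta>\<in>sphere 0 1. {x. x \<bullet> \<theta> \<le> \<gamma> \<theta>})"

(* The pair (\<theta>, r) in polar plot expression denotes the point r \<theta>. *)
definition polar_point :: "'a::euclidean_space \<Rightarrow> real \<Rightarrow> 'a" where
  "polar_point \<theta> r = r *\<^sub>R \<theta>"

definition polar_graph :: "('a::euclidean_space \<Rightarrow> real) \<Rightarrow> 'a set" where
  "polar_graph \<gamma> = {polar_point \<theta> (\<gamma> \<theta>) | \<theta>. \<theta> \<in> sphere 0 1}"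

(* The polar coordinates of x \<noteq> 0 are (sgn x, norm x), where sgn x = x /\<^sub>R norm x, so this is
   (\<theta>, r) \<mapsto> (-\<theta>, 1/r); the value at 0 is irrelevant. *)
definition inversion :: "'a::euclidean_space \<Rightarrow> 'a" where
  "inversion x = polar_point (- sgn x) (1 / norm x)"

lemma inversion_polar_point:
  assumes "\<theta> \<in> sphere 0 1" and "r > 0"
  shows "inversion (polar_point \<theta> r) = polar_point (- \<theta>) (1 / r)"
  using assms by (simp add: inversion_def polar_point_def sgn_div_norm)

definition convex_integrand :: "('a::euclidean_space \<Rightarrow> real) \<Rightarrow> bool" where
  "convex_integrand \<gamma> \<longleftrightarrow>
     continuous_on (sphere 0 1) \<gamma> \<and>
     (\<forall>\<theta>\<in>sphere 0 1. \<gamma> \<theta> > 0) \<and>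
     inversion ` polar_graph \<gamma> = frontier (convex hull (inversion ` polar_graph \<gamma>))"

end

theory Submission
  imports Defs
begin

text \<open>
  For every continuous positive \<open>\<gamma>\<close>, the Wulff shape is a compact convex set, and \<open>\<gamma>\<close> bounds its
  support function from above. Being a convex integrand makes this bound sharp in every direction
  (\<open>Wulff_shape_support_attained\<close>): a hyperplane that supports the convex hull of the inverted
  graph at the point \<open>- \<theta> / \<gamma> \<theta>\<close> is dual to a point of the Wulff shape at which the
  functional \<open>x \<mapsto> x \<bullet> \<theta>\<close> takes the value \<open>\<gamma> \<theta>\<close>.

  Sharpness determines the Wulff shape of the maximum. One inclusion is monotonicity. For the
  other, suppose that \<open>x\<close> lies outside the convex hull of the two Wulff shapes. That hull is compact,
  so some unit vector \<open>\<theta>\<close> strictly separates: \<open>x \<bullet> \<theta>\<close> exceeds \<open>y \<bullet> \<theta>\<close> for all \<open>y\<close> in the hull,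
  hence, by sharpness, exceeds both \<open>\<gamma>1 \<theta>\<close> and \<open>\<gamma>2 \<theta>\<close>, so that \<open>x\<close> violates the constraint in direction \<open>\<theta>\<close>.
\<close>

lemma Wulff_shape_iff:
  "x \<in> Wulff_shape \<gamma> \<longleftrightarrow> (\<forall>\<theta>\<in>sphere 0 1. x \<bullet> \<theta> \<le> \<gamma> \<theta>)"
  by (auto simp: Wulff_shape_def)

lemma Wulff_shape_mono:
  assumes "\<And>\<theta>. \<theta> \<in> sphere 0 1 \<Longrightarrow> \<gamma> \<theta> \<le> \<delta> \<theta>"
  shows "Wulff_shape \<gamma> \<subseteq> Wulff_shape \<delta>"
  using assms by (force simp: Wulff_shape_iff)

lemma Wulff_shape_eq_halfspaces:
  "Wulff_shape \<gamma> = (\<Inter>\<theta>\<in>sphere 0 1. {x. \<theta> \<bullet> x \<le> \<gamma> \<theta>})"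
  by (simp add: Wulff_shape_def inner_commute)

lemma convex_Wulff_shape: "convex (Wulff_shape \<gamma>)"
  unfolding Wulff_shape_eq_halfspaces by (intro convex_INT convex_halfspace_le)

lemma closed_Wulff_shape: "closed (Wulff_shape \<gamma>)"
  unfolding Wulff_shape_eq_halfspaces by (intro closed_INT ballI closed_halfspace_le)

text \<open>Testing a nonzero point against its own direction bounds its norm by the maximum of \<open>\<gamma>\<close>.\<close>

lemma compact_Wulff_shape:
  assumes "continuous_on (sphere 0 1) \<gamma>"
  shows "compact (Wulff_shape \<gamma>)"
proof -
  have "bounded (\<gamma> ` sphere 0 1)"
    using assms by (intro compact_imp_bounded compact_continuous_image compact_sphere)
  then obtain B where B: "B > 0" "\<And>\<theta>. \<theta> \<in> sphere 0 1 \<Longrightarrow> \<bar>\<gamma> \<theta>\<bar> \<le> B"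
    unfolding bounded_pos by auto
  have "norm x \<le> B" if x: "x \<in> Wulff_shape \<gamma>" for x
  proof (cases "x = 0")
    case False
    then have s: "sgn x \<in> sphere 0 1"
      by (simp add: norm_sgn)
    have "norm x = x \<bullet> sgn x"
      using False by (simp add: sgn_div_norm dot_square_norm power2_eq_square)
    also have "\<dots> \<le> \<gamma> (sgn x)"
      using x s by (simp add: Wulff_shape_iff)
    also have "\<dots> \<le> B"
      using B(2)[OF s] by simp
    finally show ?thesis .
  qed (use B in simp)
  then have "bounded (Wulff_shape \<gamma>)"
    unfolding bounded_iff by blast
  then show ?thesis
    using closed_Wulff_shape by (simp add: compact_eq_bounded_closed)
qed

lemma inversion_polar_graph:
  assumes "\<And>\<theta>. \<theta> \<in> sphere 0 1 \<Longrightarrow> \<gamma> \<theta> > 0"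
  shows "inversion ` polar_graph \<gamma> = (\<lambda>\<theta>. (1 / \<gamma> \<theta>) *\<^sub>R (- \<theta>)) ` sphere 0 1"
proof -
  have "inversion ` polar_graph \<gamma> = (\<lambda>\<theta>. inversion (polar_point \<theta> (\<gamma> \<theta>))) ` sphere 0 1"
    unfolding polar_graph_def by blast
  also have "\<dots> = (\<lambda>\<theta>. (1 / \<gamma> \<theta>) *\<^sub>R (- \<theta>)) ` sphere 0 1"
    using inversion_polar_point assms
    by (intro image_cong refl) (auto simp: polar_point_def[of "- _"])
  finally show ?thesis .
qed

text \<open>
  A convex set with empty interior lies in a hyperplane, which supports it everywhere; otherwise
  the point can be separated from the interior, and the inequality passes to the closure.
\<close>

lemma convex_supporting_hyperplane:
  fixes S :: "'a::euclidean_space set"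
  assumes "convex S" "p \<in> S" "p \<notin> interior S"
  obtains a where "a \<noteq> 0" "\<And>z. z \<in> S \<Longrightarrow> a \<bullet> p \<le> a \<bullet> z"
proof (cases "interior S = {}")
  case True
  obtain a b where "a \<noteq> 0" "S \<subseteq> {x. a \<bullet> x = b}"
    using empty_interior_subset_hyperplane[OF assms(1) True] .
  then have "a \<bullet> p \<le> a \<bullet> z" if "z \<in> S" for z
    using that assms(2) by (metis (mono_tags) mem_Collect_eq order_refl subsetD)
  with \<open>a \<noteq> 0\<close> that show ?thesis by blast
next
  case False
  obtain a b where a: "a \<noteq> 0" "a \<bullet> p \<le> b" "\<forall>z\<in>interior S. a \<bullet> z \<ge> b"
    using separating_hyperplane_sets[of "{p}" "interior S"] assms False
    by (auto simp: convex_interior)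
  have "closure (interior S) \<subseteq> {z. a \<bullet> z \<ge> b}"
    using a(3) by (intro closure_minimal closed_halfspace_ge) auto
  then have "S \<subseteq> {z. a \<bullet> z \<ge> b}"
    using convex_closure_interior[OF assms(1) False] closure_subset[of S] by blast
  with a that show ?thesis by force
qed

text \<open>
  A supporting functional \<open>a\<close> at the
  inverted point in direction \<open>\<theta>\<close> says that \<open>\<theta>\<close> maximises the ratio \<open>(a \<bullet> \<phi>) / \<gamma> \<phi>\<close> over the sphere.
  The maximum is positive, as \<open>\<phi> = sgn a\<close> shows, and dividing \<open>a\<close> by it gives the required point.
\<close>

lemma Wulff_shape_support_attained:
  assumes \<gamma>: "convex_integrand \<gamma>" and \<theta>: "\<theta> \<in> sphere 0 1"
  obtains y where "y \<in> Wulff_shape \<gamma>" "y \<bullet> \<theta> = \<gamma> \<theta>"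
proof -
  have pos: "\<gamma> \<phi> > 0" if "\<phi> \<in> sphere 0 1" for \<phi>
    using \<gamma> that by (simp add: convex_integrand_def)
  define q where "q \<phi> = (1 / \<gamma> \<phi>) *\<^sub>R (- \<phi>)" for \<phi>
  define K where "K = convex hull (q ` sphere 0 1)"
  have "q ` sphere 0 1 = frontier K"
    using \<gamma> inversion_polar_graph[of \<gamma>] pos by (simp add: convex_integrand_def K_def q_def)
  then have "q \<theta> \<notin> interior K"
    using \<theta> by (auto simp: frontier_def)
  moreover have qK: "q \<phi> \<in> K" if "\<phi> \<in> sphere 0 1" for \<phi>
    using that unfolding K_def by (intro hull_inc imageI)
  ultimately obtain a where a: "a \<noteq> 0" "\<And>z. z \<in> K \<Longrightarrow> a \<bullet> q \<theta> \<le> a \<bullet> z"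
    using convex_supporting_hyperplane[of K "q \<theta>"] \<theta> by (auto simp: K_def convex_convex_hull)
  define m where "m = (a \<bullet> \<theta>) / \<gamma> \<theta>"
  have le_m: "(a \<bullet> \<phi>) / \<gamma> \<phi> \<le> m" if "\<phi> \<in> sphere 0 1" for \<phi>
    using a(2)[OF qK[OF that]] by (simp add: q_def m_def)
  have s: "sgn a \<in> sphere 0 1"
    using a by (simp add: norm_sgn)
  have "a \<bullet> sgn a > 0"
    using a by (simp add: sgn_div_norm)
  then have "m > 0"
    using le_m[OF s] pos[OF s] by (smt (verit) divide_pos_pos)
  show ?thesis
  proof (rule that)
    show "(1 / m) *\<^sub>R a \<in> Wulff_shape \<gamma>"
      unfolding Wulff_shape_iff
      using le_m pos \<open>m > 0\<close> by (simp add: field_simps)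
    show "((1 / m) *\<^sub>R a) \<bullet> \<theta> = \<gamma> \<theta>"
      using \<open>m > 0\<close> pos[OF \<theta>] by (auto simp: m_def field_simps)
  qed
qed

theorem theorem1:
  fixes n :: nat
    and \<gamma>1 \<gamma>2 \<gamma>max :: "real ^ 'd \<Rightarrow> real"
  assumes "n \<ge> 1"
    and "CARD('d) = n + 1"
    and "convex_integrand \<gamma>1"
    and "convex_integrand \<gamma>2"
    and "\<And>\<theta>. \<theta> \<in> sphere 0 1 \<Longrightarrow> \<gamma>max \<theta> = max (\<gamma>1 \<theta>) (\<gamma>2 \<theta>)"
  shows "Wulff_shape \<gamma>max = convex hull (Wulff_shape \<gamma>1 \<union> Wulff_shape \<gamma>2)"
proof (rule antisym)
  let ?C = "convex hull (Wulff_shape \<gamma>1 \<union> Wulff_shape \<gamma>2)"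
  have sub: "Wulff_shape \<gamma>1 \<subseteq> Wulff_shape \<gamma>max" "Wulff_shape \<gamma>2 \<subseteq> Wulff_shape \<gamma>max"
    using assms(5) by (auto intro!: Wulff_shape_mono)
  then show "?C \<subseteq> Wulff_shape \<gamma>max"
    by (intro hull_minimal convex_Wulff_shape) auto
  have "compact ?C"
    using assms(3,4)
    by (intro compact_convex_hull compact_Un compact_Wulff_shape) (auto simp: convex_integrand_def)
  show "Wulff_shape \<gamma>max \<subseteq> ?C"
  proof (rule subsetI, rule ccontr)
    fix x assume x: "x \<in> Wulff_shape \<gamma>max" "x \<notin> ?C"
    obtain a b where ab: "a \<bullet> x < b" "\<And>y. y \<in> ?C \<Longrightarrow> a \<bullet> y > b"
      using separating_hyperplane_closed_point[OF convex_convex_hull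
          compact_imp_closed[OF \<open>compact ?C\<close>] x(2)] by blast
    \<comment> \<open>The origin lies in a Wulff shape, so the separating functional cannot vanish.\<close>
    have "0 \<in> Wulff_shape \<gamma>1"
      using assms(3) by (auto simp: Wulff_shape_iff convex_integrand_def less_imp_le)
    then have "a \<noteq> 0"
      using ab(1) ab(2)[of 0] by (auto simp: hull_inc)
    \<comment> \<open>\<open>a\<close> is smaller at \<open>x\<close> than on the hull; the sign reverses the inequality.\<close>
    define \<theta> where "\<theta> = - sgn a"
    have \<theta>: "\<theta> \<in> sphere 0 1"
      using \<open>a \<noteq> 0\<close> by (simp add: \<theta>_def norm_sgn)
    have sep: "y \<bullet> \<theta> < x \<bullet> \<theta>" if "y \<in> Wulff_shape \<gamma>1 \<union> Wulff_shape \<gamma>2" for y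
    proof -
      have "a \<bullet> x < a \<bullet> y"
        using ab(1) ab(2)[OF hull_inc[OF that]] by simp
      then show ?thesis
        using \<open>a \<noteq> 0\<close> by (simp add: \<theta>_def sgn_div_norm inner_commute)
    qed
    obtain y1 where "y1 \<in> Wulff_shape \<gamma>1" "y1 \<bullet> \<theta> = \<gamma>1 \<theta>"
      using Wulff_shape_support_attained[OF assms(3) \<theta>] .
    moreover obtain y2 where "y2 \<in> Wulff_shape \<gamma>2" "y2 \<bullet> \<theta> = \<gamma>2 \<theta>"
      using Wulff_shape_support_attained[OF assms(4) \<theta>] .
    ultimately have "\<gamma>max \<theta> < x \<bullet> \<theta>"
      using sep[of y1] sep[of y2] assms(5)[OF \<theta>] by simp
    with x(1) \<theta> show False
      by (force simp: Wulff_shape_iff)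
  qed
qed

end
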